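(* Let $R$ be an integral domain and let $A$ be an $n\times n$ matrix all of whose entries are non-zero elements of $R$. Suppose that for all integers $i,j$ with $1\le i<j\le n-1$, $$A_{i,j}A_{j,j+1}A_{j+1,i}=A_{j,i}A_{j+1,j}A_{i,j+1}.$$ Then for any positive integer $k$, any $k$ positive integers $m_1,m_2,\ldots,m_k$, and any sequence of integers $i_1,i_2,\ldots,i_k$ with $1\le i_t\le n$ for every $t$, we have $$(A^{m_1})_{i_1i_2}(A^{m_2})_{i_2i_3}\cdots (A^{m_k})_{i_ki_1} = (A^{m_1})_{i_2i_1}(A^{m_2})_{i_3i_2}\cdots (A^{m_k})_{i_1i_k}.$$ (That is, with $i_{k+1}:=i_1$, $\prod_{t=1}^k (A^{m_t})_{i_t i_{t+1}}=\prod_{t=1}^k (A^{m_t})_{i_{t+1} i_t}$.)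
   Context: $B_{ij}$ (also written $B_{i,j}$) denotes the $(i,j)$-th entry of a matrix $B$. *)

theory Defs
  imports "Jordan_Normal_Form.Matrix"
begin

end

(* If d i * A(i,j) = d j * A(j,i) for all i, j with every d i nonzero, i.e. D A is symmetric for an
   invertible diagonal matrix D over the fraction field, then the same d works for every power of A,
   and multiplying along a closed walk the factors d cancel.  The requirement on the neighbouring
   pairs (i, i + 1) determines d up to a scalar, and the triangle condition propagates the relation
   to all pairs.  Clearing denominators keeps d inside the ring. *)

theory Submission
  imports Defs
begin

text \<open>The recursion of \<open>^\<^sub>m\<close> puts the new factor on the right. The symmetry
  argument for powers also needs it on the left, since swapping the two indices of an entry reverses
  the order of the factors.\<close>

lemma pow_mat_Suc_left:
  fixes A :: "'a :: semiring_1 mat"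
  assumes A: "A \<in> carrier_mat n n"
  shows "A ^\<^sub>m Suc m = A * A ^\<^sub>m m"
proof (induction m)
  case 0
  then show ?case using A by simp
next
  case (Suc m)
  have "A ^\<^sub>m Suc (Suc m) = A * A ^\<^sub>m m * A"
    using Suc by simp
  also have "\<dots> = A * A ^\<^sub>m Suc m"
    using A by (simp add: assoc_mult_mat[OF A pow_carrier_mat[OF A] A])
  finally show ?case .
qed

lemma symmetrizable_pow_mat:
  fixes A :: "'a :: comm_semiring_1 mat"
  assumes A: "A \<in> carrier_mat n n"
    and sym: "\<And>i j. i < n \<Longrightarrow> j < n \<Longrightarrow> d i * A $$ (i, j) = d j * A $$ (j, i)"
    and "i < n" "j < n"
  shows "d i * (A ^\<^sub>m m) $$ (i, j) = d j * (A ^\<^sub>m m) $$ (j, i)"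
  using \<open>i < n\<close> \<open>j < n\<close>
proof (induction m arbitrary: i j)
  case 0
  then show ?case using A by (cases "i = j") auto
next
  case (Suc m)
  have P: "A ^\<^sub>m m \<in> carrier_mat n n"
    using A by simp
  have "d i * (A ^\<^sub>m Suc m) $$ (i, j) = (\<Sum>l<n. d i * (A ^\<^sub>m m) $$ (i, l) * A $$ (l, j))"
    using A P Suc.prems
    by (simp add: scalar_prod_def sum_distrib_left mult.assoc atLeast0LessThan)
  \<comment> \<open>In each summand the weight travels along the walk: from \<open>i\<close> to
    \<open>l\<close> by the induction hypothesis, then from \<open>l\<close> to \<open>j\<close> by
    \<open>sym\<close>.\<close>
  also have "\<dots> = (\<Sum>l<n. d j * A $$ (j, l) * (A ^\<^sub>m m) $$ (l, i))"
  proof (rule sum.cong[OF refl])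
    fix l assume "l \<in> {..<n}"
    then have l: "l < n" by simp
    have "d i * (A ^\<^sub>m m) $$ (i, l) * A $$ (l, j) = (d l * A $$ (l, j)) * (A ^\<^sub>m m) $$ (l, i)"
      using Suc.IH[OF Suc.prems(1) l] by (simp add: ac_simps)
    then show "d i * (A ^\<^sub>m m) $$ (i, l) * A $$ (l, j) = d j * A $$ (j, l) * (A ^\<^sub>m m) $$ (l, i)"
      using sym[OF l Suc.prems(2)] by simp
  qed
  also have "\<dots> = d j * (A ^\<^sub>m Suc m) $$ (j, i)"
    unfolding pow_mat_Suc_left[OF A] using A P Suc.prems
    by (simp add: scalar_prod_def sum_distrib_left mult.assoc atLeast0LessThan)
  finally show ?case .
qed

lemma triangle_condition_symmetrizable:
  fixes A :: "'a :: idom mat"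
  assumes nonzero: "\<And>i j. i < n \<Longrightarrow> j < n \<Longrightarrow> A $$ (i, j) \<noteq> 0"
    and triangles: "\<And>i j. i < j \<Longrightarrow> j + 1 < n \<Longrightarrow>
      A $$ (i, j) * A $$ (j, j + 1) * A $$ (j + 1, i) =
      A $$ (j, i) * A $$ (j + 1, j) * A $$ (i, j + 1)"
  obtains d where "\<And>i. i < n \<Longrightarrow> d i \<noteq> 0"
    and "\<And>i j. i < n \<Longrightarrow> j < n \<Longrightarrow> d i * A $$ (i, j) = d j * A $$ (j, i)"
proof
  \<comment> \<open>For \<open>i < n\<close> this is the product over \<open>l < i\<close> of the
    ratios \<open>A $$ (l, l + 1) / A $$ (l + 1, l)\<close>, multiplied by the common denominator,
    the product of all \<open>A $$ (l + 1, l)\<close> with \<open>l < n - 1\<close>.\<close>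
  define d where
    "d i = (\<Prod>l<i. A $$ (l, l + 1)) * (\<Prod>l=i..<n - 1. A $$ (l + 1, l))" for i
  show d_nonzero: "d i \<noteq> 0" if "i < n" for i
    using that nonzero unfolding d_def by auto
  \<comment> \<open>\<open>d j\<close> and \<open>d (j + 1)\<close> differ only in the factor for
    \<open>l = j\<close>, which is \<open>A $$ (j + 1, j)\<close> in the first and
    \<open>A $$ (j, j + 1)\<close> in the second.\<close>
  have adjacent: "d j * A $$ (j, j + 1) = d (j + 1) * A $$ (j + 1, j)" if "j + 1 < n" for j
    using that unfolding d_def by (simp add: prod.atLeast_Suc_lessThan ac_simps)
  have upper: "d i * A $$ (i, j) = d j * A $$ (j, i)" if "i < j" "j < n" for i j
    using that
  proof (induction j)
    case 0
    then show ?case by simp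
  next
    case (Suc j)
    show ?case
    proof (cases "i = j")
      case True
      then show ?thesis using adjacent[of j] Suc.prems by simp
    next
      case False
      \<comment> \<open>Multiplying by \<open>?c\<close> completes \<open>A $$ (i, j + 1)\<close> to
        one side of the triangle condition for \<open>i\<close>, \<open>j\<close>,
        \<open>j + 1\<close>. The induction hypothesis and \<open>adjacent\<close> then handle the
        other side, and \<open>?c\<close> cancels because it is nonzero in a domain.\<close>
      let ?c = "d j * A $$ (j, i) * A $$ (j + 1, j)"
      from False Suc.prems have j: "i < j" "j + 1 < n" by auto
      have IH: "d i * A $$ (i, j) = d j * A $$ (j, i)"
        using Suc.IH j by simp
      have "?c * (d i * A $$ (i, j + 1))
          = d i * d j * (A $$ (j, i) * A $$ (j + 1, j) * A $$ (i, j + 1))"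
        by (simp only: ac_simps)
      also have "\<dots> = d i * d j * (A $$ (i, j) * A $$ (j, j + 1) * A $$ (j + 1, i))"
        by (simp only: triangles[OF j])
      also have "\<dots> = (d i * A $$ (i, j)) * (d j * A $$ (j, j + 1)) * A $$ (j + 1, i)"
        by (simp only: ac_simps)
      also have "\<dots> = (d j * A $$ (j, i)) * (d (j + 1) * A $$ (j + 1, j)) * A $$ (j + 1, i)"
        by (simp only: IH adjacent[OF j(2)])
      also have "\<dots> = ?c * (d (j + 1) * A $$ (j + 1, i))"
        by (simp only: ac_simps)
      finally have "?c * (d i * A $$ (i, j + 1)) = ?c * (d (j + 1) * A $$ (j + 1, i))" .
      moreover have "?c \<noteq> 0"
        using d_nonzero nonzero j by simp
      ultimately show ?thesis by simp
    qed
  qed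
  show "d i * A $$ (i, j) = d j * A $$ (j, i)" if "i < n" "j < n" for i j
    using upper[of i j] upper[of j i] that by (cases i j rule: linorder_cases) auto
qed

text \<open>Only the last index wraps around, so its factor \<open>f 0\<close> moves to the
  front.\<close>

lemma prod_cyclic_shift:
  fixes f :: "nat \<Rightarrow> 'a :: comm_monoid_mult"
  shows "(\<Prod>t<k. f ((t + 1) mod k)) = (\<Prod>t<k. f t)"
proof (cases k)
  case (Suc k')
  have "(\<Prod>t<Suc k'. f ((t + 1) mod Suc k')) = (\<Prod>t<k'. f (Suc t)) * f 0"
    by simp
  also have "\<dots> = (\<Prod>t<Suc k'. f t)"
    by (simp only: prod.lessThan_Suc_shift mult.commute)
  finally show ?thesis using Suc by simp
qed simp

theorem theorem1p3:
  fixes A :: "'a :: idom mat" and n k :: nat and m idx :: "nat \<Rightarrow> nat"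
  assumes A: "A \<in> carrier_mat n n"
    and nonzero: "\<And>i j. i < n \<Longrightarrow> j < n \<Longrightarrow> A $$ (i, j) \<noteq> 0"
    and triangles: "\<And>i j. i < j \<Longrightarrow> j + 1 < n \<Longrightarrow>
      A $$ (i, j) * A $$ (j, j + 1) * A $$ (j + 1, i) =
      A $$ (j, i) * A $$ (j + 1, j) * A $$ (i, j + 1)"
    and k: "k > 0"
    and m: "\<And>t. t < k \<Longrightarrow> m t > 0"
    and idx: "\<And>t. t < k \<Longrightarrow> idx t < n"
  shows "(\<Prod>t<k. (A ^\<^sub>m m t) $$ (idx t, idx ((t + 1) mod k))) =
         (\<Prod>t<k. (A ^\<^sub>m m t) $$ (idx ((t + 1) mod k), idx t))"
    (is "?L = ?R")
proof -
  obtain d where d_nonzero: "\<And>i. i < n \<Longrightarrow> d i \<noteq> 0"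
    and sym: "\<And>i j. i < n \<Longrightarrow> j < n \<Longrightarrow> d i * A $$ (i, j) = d j * A $$ (j, i)"
    using triangle_condition_symmetrizable[OF nonzero triangles] by blast
  let ?D = "\<Prod>t<k. d (idx t)"
  have "?D * ?L = (\<Prod>t<k. d (idx t) * (A ^\<^sub>m m t) $$ (idx t, idx ((t + 1) mod k)))"
    by (simp only: prod.distrib)
  also have "\<dots> = (\<Prod>t<k. d (idx ((t + 1) mod k)) * (A ^\<^sub>m m t) $$ (idx ((t + 1) mod k), idx t))"
  proof (rule prod.cong[OF refl])
    fix t assume "t \<in> {..<k}"
    then show "d (idx t) * (A ^\<^sub>m m t) $$ (idx t, idx ((t + 1) mod k))
        = d (idx ((t + 1) mod k)) * (A ^\<^sub>m m t) $$ (idx ((t + 1) mod k), idx t)"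
      using symmetrizable_pow_mat[OF A sym] idx k by simp
  qed
  \<comment> \<open>The walk is closed, so the endpoints of its steps are the starting points
    shifted cyclically, and their weights multiply to \<open>?D\<close> again.\<close>
  also have "\<dots> = ?D * ?R"
    by (simp only: prod.distrib prod_cyclic_shift[of "\<lambda>t. d (idx t)"])
  finally have "?D * ?L = ?D * ?R" .
  moreover have "?D \<noteq> 0"
    using d_nonzero idx by simp
  ultimately show ?thesis by simp
qed

end
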